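(* Consider the timelike geodesics $(\phi(s),\chi_1(s),\chi_2(s))$ (defined in the context) starting from the point $\phi(0)=0$, $\chi_1(0)=0$, $\chi_2(0)=\chi_2^{(0)}$ with some $\dot\phi(0)\neq0$ and a constant value of $\dot\chi_2$ (and no prescribed condition on $\dot\chi_1(s)$). They satisfy the following equations, with an appropriate choice of sign $\pm$, for $s$ in an interval around $0$ on which $\phi(s)\in(-\frac\pi2,\frac\pi2)$. In all cases $\chi_2(s)=\dot\chi_2 s+\chi_2^{(0)}$, and: (i) if $4\dot\chi_2^2=\dot\phi^2(0)$, then $$\sin\phi(s)=\pm|\dot\phi(0)|\,s,\qquad \chi_1(s)=-\dot\chi_2 s+\frac{\dot\chi_2}{2\dot\phi(0)}\ln\left|\frac{1+\dot\phi(0)s}{1-\dot\phi(0)s}\right|;$$ (ii) if $4\dot\chi_2^2>\dot\phi^2(0)$, then $$\sin\phi(s)=\pm\sqrt{\frac{\dot\phi^2(0)}{4\dot\chi_2^2-\dot\phi^2(0)}}\,\sinh\!\Big(s\sqrt{4\dot\chi_2^2-\dot\phi^2(0)}\Big),$$ $$\chi_1(s)=-\dot\chi_2 s+\dot\chi_2\int_0^s\frac{4\dot\chi_2^2-\dot\phi^2(0)}{4\dot\chi_2^2-\dot\phi^2(0)\cosh^2\!\big(t\sqrt{4\dot\chi_2^2-\dot\phi^2(0)}\big)}\,dt;$$ (iii) if $4\dot\chi_2^2<\dot\phi^2(0)$, then $$\sin\phi(s)=\pm\sqrt{\frac{\dot\phi^2(0)}{\dot\phi^2(0)-4\dot\chi_2^2}}\,\sin\!\Big(s\sqrt{\dot\phi^2(0)-4\dot\chi_2^2}\Big),$$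 $$\chi_1(s)=-\dot\chi_2 s+\dot\chi_2\int_0^s\frac{\dot\phi^2(0)-4\dot\chi_2^2}{\dot\phi^2(0)\cos^2\!\big(t\sqrt{\dot\phi^2(0)-4\dot\chi_2^2}\big)-4\dot\chi_2^2}\,dt.$$
   Context: $AdS=\{x\in\mathbb R^4:-x_1^2-x_2^2+x_3^2+x_4^2=-1\}$. Near $(1,0,0,0)$ one uses the parametrization $x_1=\cos\phi\cosh\chi_1$, $x_2=\sin\phi\cosh\chi_2$, $x_3=\sin\phi\sinh\chi_2$, $x_4=\cos\phi\sinh\chi_1$, with $\phi\in(-\frac\pi2,\frac\pi2)$, $\chi_1,\chi_2\in\mathbb R$. In this theorem the geodesics are the projections $(\phi,\chi_1,\chi_2)$ of solutions of the Hamiltonian system with Hamiltonian $$H(\phi,\chi_1,\chi_2,\psi,\xi_1,\xi_2)=\tfrac12\big(-4\psi^2+\xi_1^2\tan^2\phi+\xi_2^2\cot^2\phi+2\xi_1\xi_2\big),$$ where $\psi,\xi_1,\xi_2$ are the momenta conjugate to $\phi,\chi_1,\chi_2$, with $\xi_2=0$. That is, $\xi_1$ is a constant, $\xi_2=0$, and $$\dot\chi_1=\xi_1\tan^2\phi,\quad \dot\chi_2=\xi_1,\quad \dot\phi=-4\psi,\quad \dot\psi=-\xi_1^2\frac{\tan\phi}{\cos^2\phi}.$$ The condition $\dot\phi(0)\neq0$ is what the paper means by the geodesic being timelike. *)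

theory Defs
  imports "HOL-Analysis.Analysis"
begin

(* At phi = 0 the library convention makes cot 0 = 0.  Geodesics below have xi2 = 0, and there the
   cot term and its first-order partial derivatives vanish for every value of cot, so this
   convention does not affect them (see geodesic_iff). *)
definition hamiltonian :: "real \<Rightarrow> real \<Rightarrow> real \<Rightarrow> real \<Rightarrow> real \<Rightarrow> real \<Rightarrow> real" where
  "hamiltonian \<phi> \<chi>1 \<chi>2 \<psi> \<xi>1 \<xi>2 =
     1 / 2 * (- 4 * \<psi>\<^sup>2 + \<xi>1\<^sup>2 * (tan \<phi>)\<^sup>2 + \<xi>2\<^sup>2 * (cot \<phi>)\<^sup>2 + 2 * \<xi>1 * \<xi>2)"

(* The derivatives are taken within I, so they are one-sided at endpoints belonging to I. *)
definition hamilton_solution ::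
  "(real \<Rightarrow> real \<Rightarrow> real \<Rightarrow> real \<Rightarrow> real \<Rightarrow> real \<Rightarrow> real) \<Rightarrow> real set \<Rightarrow>
   (real \<Rightarrow> real) \<Rightarrow> (real \<Rightarrow> real) \<Rightarrow> (real \<Rightarrow> real) \<Rightarrow>
   (real \<Rightarrow> real) \<Rightarrow> (real \<Rightarrow> real) \<Rightarrow> (real \<Rightarrow> real) \<Rightarrow> bool" where
  "hamilton_solution H I \<phi> \<chi>1 \<chi>2 \<psi> \<xi>1 \<xi>2 \<longleftrightarrow>
    (\<forall>s\<in>I.
      (\<phi> has_real_derivative
         deriv (\<lambda>p. H (\<phi> s) (\<chi>1 s) (\<chi>2 s) p (\<xi>1 s) (\<xi>2 s)) (\<psi> s)) (at s within I) \<and>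
      (\<chi>1 has_real_derivative
         deriv (\<lambda>p. H (\<phi> s) (\<chi>1 s) (\<chi>2 s) (\<psi> s) p (\<xi>2 s)) (\<xi>1 s)) (at s within I) \<and>
      (\<chi>2 has_real_derivative
         deriv (\<lambda>p. H (\<phi> s) (\<chi>1 s) (\<chi>2 s) (\<psi> s) (\<xi>1 s) p) (\<xi>2 s)) (at s within I) \<and>
      (\<psi> has_real_derivative
         - deriv (\<lambda>q. H q (\<chi>1 s) (\<chi>2 s) (\<psi> s) (\<xi>1 s) (\<xi>2 s)) (\<phi> s)) (at s within I) \<and>
      (\<xi>1 has_real_derivative
         - deriv (\<lambda>q. H (\<phi> s) q (\<chi>2 s) (\<psi> s) (\<xi>1 s) (\<xi>2 s)) (\<chi>1 s)) (at s within I) \<and>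
      (\<xi>2 has_real_derivative
         - deriv (\<lambda>q. H (\<phi> s) (\<chi>1 s) q (\<psi> s) (\<xi>1 s) (\<xi>2 s)) (\<chi>2 s)) (at s within I))"

definition geodesic ::
  "real set \<Rightarrow> (real \<Rightarrow> real) \<Rightarrow> (real \<Rightarrow> real) \<Rightarrow> (real \<Rightarrow> real) \<Rightarrow> bool" where
  "geodesic I \<phi> \<chi>1 \<chi>2 \<longleftrightarrow>
    (\<forall>s\<in>I. \<phi> s \<in> {- pi / 2 <..< pi / 2}) \<and>
    (\<exists>\<psi> \<xi>1 \<xi>2. (\<forall>s\<in>I. \<xi>2 s = 0) \<and> hamilton_solution hamiltonian I \<phi> \<chi>1 \<chi>2 \<psi> \<xi>1 \<xi>2)"

lemma deriv_hamiltonian: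
  "deriv (\<lambda>p. hamiltonian \<phi> \<chi>1 \<chi>2 p \<xi>1 \<xi>2) \<psi> = - 4 * \<psi>"
  "deriv (\<lambda>p. hamiltonian \<phi> \<chi>1 \<chi>2 \<psi> p 0) \<xi>1 = \<xi>1 * (tan \<phi>)\<^sup>2"
  "deriv (\<lambda>p. hamiltonian \<phi> \<chi>1 \<chi>2 \<psi> \<xi>1 p) 0 = \<xi>1"
  "deriv (\<lambda>q. hamiltonian \<phi> q \<chi>2 \<psi> \<xi>1 \<xi>2) \<chi>1 = 0"
  "deriv (\<lambda>q. hamiltonian \<phi> \<chi>1 q \<psi> \<xi>1 \<xi>2) \<chi>2 = 0"
  unfolding hamiltonian_def
  by (auto intro!: DERIV_imp_deriv derivative_eq_intros)

lemma deriv_hamiltonian_phi: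
  assumes "cos \<phi> \<noteq> 0"
  shows "deriv (\<lambda>q. hamiltonian q \<chi>1 \<chi>2 \<psi> \<xi>1 0) \<phi> = \<xi>1\<^sup>2 * (tan \<phi> / (cos \<phi>)\<^sup>2)"
proof (rule DERIV_imp_deriv)
  show "((\<lambda>q. hamiltonian q \<chi>1 \<chi>2 \<psi> \<xi>1 0) has_real_derivative
      \<xi>1\<^sup>2 * (tan \<phi> / (cos \<phi>)\<^sup>2)) (at \<phi>)"
    unfolding hamiltonian_def using assms
    by (auto intro!: derivative_eq_intros simp: field_simps)
qed

lemma geodesic_iff:
  assumes "is_interval I"
  shows "geodesic I \<phi> \<chi>1 \<chi>2 \<longleftrightarrow>
    (\<forall>s\<in>I. \<phi> s \<in> {- pi / 2 <..< pi / 2}) \<and>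
    (\<exists>\<psi> \<xi>1. \<forall>s\<in>I.
      (\<chi>1 has_real_derivative \<xi>1 * (tan (\<phi> s))\<^sup>2) (at s within I) \<and>
      (\<chi>2 has_real_derivative \<xi>1) (at s within I) \<and>
      (\<phi> has_real_derivative - 4 * \<psi> s) (at s within I) \<and>
      (\<psi> has_real_derivative - \<xi>1\<^sup>2 * (tan (\<phi> s) / (cos (\<phi> s))\<^sup>2)) (at s within I))"
  (is "_ \<longleftrightarrow> ?R \<and> ?E")
proof (cases "?R")
  case True
  have c: "cos (\<phi> s) \<noteq> 0" if "s \<in> I" for s
    using True that cos_gt_zero_pi[of "\<phi> s"] by fastforce
  note d = deriv_hamiltonian deriv_hamiltonian_phi[OF c]
  have "geodesic I \<phi> \<chi>1 \<chi>2 \<longleftrightarrow> ?E"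
  proof
    assume "geodesic I \<phi> \<chi>1 \<chi>2"
    then obtain \<psi> \<xi>1 \<xi>2 where z: "\<forall>s\<in>I. \<xi>2 s = 0"
      and h: "hamilton_solution hamiltonian I \<phi> \<chi>1 \<chi>2 \<psi> \<xi>1 \<xi>2"
      unfolding geodesic_def by blast
    have "(\<xi>1 has_real_derivative 0) (at s within I)" if "s \<in> I" for s
      using h that by (simp add: hamilton_solution_def d)
    then obtain k where k: "\<And>s. s \<in> I \<Longrightarrow> \<xi>1 s = k"
      using has_field_derivative_zero_constant[of I \<xi>1] is_interval_convex[OF assms] by blast
    show ?E
      by (rule exI[of _ \<psi>], rule exI[of _ k])
        (use h z k in \<open>simp add: hamilton_solution_def d\<close>)
  next
    assume ?E
    then obtain \<psi> k where "\<forall>s\<in>I.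
      (\<chi>1 has_real_derivative k * (tan (\<phi> s))\<^sup>2) (at s within I) \<and>
      (\<chi>2 has_real_derivative k) (at s within I) \<and>
      (\<phi> has_real_derivative - 4 * \<psi> s) (at s within I) \<and>
      (\<psi> has_real_derivative - k\<^sup>2 * (tan (\<phi> s) / (cos (\<phi> s))\<^sup>2)) (at s within I)"
      by blast
    then have "hamilton_solution hamiltonian I \<phi> \<chi>1 \<chi>2 \<psi> (\<lambda>_. k) (\<lambda>_. 0)"
      by (simp add: hamilton_solution_def d)
    then show "geodesic I \<phi> \<chi>1 \<chi>2"
      unfolding geodesic_def using True
      by (intro conjI exI[of _ \<psi>] exI[of _ "\<lambda>_. k"] exI[of _ "\<lambda>_. 0"]) simp_all
  qed
  with True show ?thesis by blast
next
  case False
  then show ?thesis unfolding geodesic_def by blast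
qed

end

theory Submission imports Defs begin

text \<open>With $y = \sin\phi$ and $v = \dot\phi$, the energy $v^2 - 4 c^2 \tan^2 \phi$ is conserved and
  equals $a^2$, and this turns the equation for $\phi$ into the linear equation
  $\ddot y = (4 c^2 - a^2) y$ with $y(0) = 0$, $\dot y(0) = a$. The three cases are the three signs
  of its coefficient, and $\dot\chi_1 = c \tan^2 \phi = c / (1 - y^2) - c$ is integrated directly.\<close>

lemma eq_if_derivative_zero:
  fixes f :: "real \<Rightarrow> real"
  assumes "convex I" "x \<in> I" "y \<in> I"
    and "\<And>t. t \<in> I \<Longrightarrow> (f has_real_derivative 0) (at t within I)"
  shows "f x = f y"
proof -
  obtain m where "\<And>t. t \<in> I \<Longrightarrow> f t = m"
    using has_field_derivative_zero_constant[of I f] assms by blast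
  then show ?thesis
    using assms by metis
qed

text \<open>\<open>S\<close> and \<open>C\<close> are the fundamental solutions of the linear equation; the Wronskian-type
  expressions \<open>y C - z S\<close> and \<open>z C - k y S\<close> are first integrals.\<close>

lemma linear_ode_unique:
  fixes y z S C :: "real \<Rightarrow> real" and k a :: real
  assumes "convex I" and I0: "0 \<in> I"
    and y: "\<And>s. s \<in> I \<Longrightarrow> (y has_real_derivative z s) (at s within I)"
    and z: "\<And>s. s \<in> I \<Longrightarrow> (z has_real_derivative k * y s) (at s within I)"
    and S: "\<And>s. s \<in> I \<Longrightarrow> (S has_real_derivative C s) (at s within I)"
    and C: "\<And>s. s \<in> I \<Longrightarrow> (C has_real_derivative k * S s) (at s within I)"
    and norm: "\<And>s. s \<in> I \<Longrightarrow> (C s)\<^sup>2 - k * (S s)\<^sup>2 = 1"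
    and "y 0 = 0" "z 0 = a" "S 0 = 0" "C 0 = 1"
    and s: "s \<in> I"
  shows "y s = a * S s"
proof -
  have "((\<lambda>s. y s * C s - z s * S s) has_real_derivative 0) (at s within I)" if "s \<in> I" for s
    by (auto intro!: derivative_eq_intros y z S C that simp: algebra_simps)
  from eq_if_derivative_zero[OF \<open>convex I\<close> s I0 this]
  have A: "y s * C s - z s * S s = 0"
    using \<open>y 0 = 0\<close> \<open>z 0 = a\<close> \<open>S 0 = 0\<close> \<open>C 0 = 1\<close> by simp
  have "((\<lambda>s. z s * C s - k * y s * S s) has_real_derivative 0) (at s within I)" if "s \<in> I" for s
    by (auto intro!: derivative_eq_intros y z S C that simp: algebra_simps)
  from eq_if_derivative_zero[OF \<open>convex I\<close> s I0 this]
  have B: "z s * C s - k * y s * S s = a"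
    using \<open>y 0 = 0\<close> \<open>z 0 = a\<close> \<open>S 0 = 0\<close> \<open>C 0 = 1\<close> by simp
  \<comment> \<open>\<open>A\<close> and \<open>B\<close> are two linear equations for
    \<open>y s\<close> and \<open>z s\<close>. Their determinant is the left side of
    \<open>norm\<close>, so \<open>z s\<close> can be eliminated without any division.\<close>
  have "y s = y s * ((C s)\<^sup>2 - k * (S s)\<^sup>2)"
    using norm s by simp
  also have "\<dots> = (y s * C s - z s * S s) * C s + (z s * C s - k * y s * S s) * S s"
    by (simp add: algebra_simps power2_eq_square)
  finally show ?thesis
    using A B by simp
qed

text \<open>The fundamental theorem of calculus on the segment between \<open>0\<close> and
  \<open>s\<close>, which lies in \<open>I\<close> whatever the sign of \<open>s\<close>. Continuity
  of \<open>f\<close> is asked on \<open>I\<close> only, since the integrands below may have poles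
  outside \<open>I\<close>.\<close>

lemma interval_integral_of_derivative:
  fixes g f :: "real \<Rightarrow> real" and c :: real
  assumes I: "is_interval I" "0 \<in> I" "s \<in> I"
    and cont: "continuous_on I f"
    and g: "\<And>t. t \<in> I \<Longrightarrow> (g has_real_derivative c * f t) (at t within I)"
  shows "interval_lebesgue_integrable lborel 0 (ereal s) f"
    and "c * (LBINT t=0..ereal s. f t) = g s - g 0"
proof -
  have sub: "{min 0 s..max 0 s} \<subseteq> I"
  proof
    fix t
    assume "t \<in> {min 0 s..max 0 s}"
    moreover have "min 0 s \<in> I" "max 0 s \<in> I"
      using I by (auto simp: min_def max_def)
    ultimately show "t \<in> I"
      using mem_is_interval_1_I[OF I(1)] unfolding atLeastAtMost_iff by blast
  qed
  then have f: "continuous_on {min 0 s..max 0 s} f"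
    using cont continuous_on_subset by blast
  have "c * (LBINT t=0..ereal s. f t) = (LBINT t=0..ereal s. c * f t)"
    by simp
  also have "\<dots> = g s - g 0"
    unfolding zero_ereal_def
  proof (rule interval_integral_FTC_finite)
    show "(g has_vector_derivative c * f t) (at t within {min 0 s..max 0 s})"
      if "min 0 s \<le> t" "t \<le> max 0 s" for t
      unfolding has_real_derivative_iff_has_vector_derivative[symmetric]
      using has_field_derivative_subset[OF g sub] sub that by auto
  qed (intro continuous_intros f)
  finally show "c * (LBINT t=0..ereal s. f t) = g s - g 0" .
  show "interval_lebesgue_integrable lborel 0 (ereal s) f"
  proof (cases "0 \<le> s")
    case True
    then show ?thesis
      unfolding zero_ereal_def using f by (intro interval_integrable_continuous_on) simp_all
  next
    case False
    then show ?thesis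
      unfolding zero_ereal_def using f
      by (subst interval_integrable_endpoints_reverse, intro interval_integrable_continuous_on) simp_all
  qed
qed

text \<open>\<open>cos (\<phi> s) * v s\<close> is the derivative of \<open>sin (\<phi> s)\<close>.
  Its own derivative is \<open>cos \<phi> * v' - sin \<phi> * v^2\<close>; conservation of energy
  eliminates \<open>v^2\<close>, and what remains is linear in \<open>sin \<phi>\<close>.\<close>

lemma sin_ode:
  fixes \<phi> v :: "real \<Rightarrow> real" and a c :: real
  assumes "convex I" and I0: "0 \<in> I"
    and range: "\<And>s. s \<in> I \<Longrightarrow> cos (\<phi> s) > 0"
    and \<phi>: "\<And>s. s \<in> I \<Longrightarrow> (\<phi> has_real_derivative v s) (at s within I)"
    and v: "\<And>s. s \<in> I \<Longrightarrow>
      (v has_real_derivative 4 * c\<^sup>2 * (tan (\<phi> s) / (cos (\<phi> s))\<^sup>2)) (at s within I)"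
    and "\<phi> 0 = 0" "v 0 = a"
    and s: "s \<in> I"
  shows "((\<lambda>s. cos (\<phi> s) * v s) has_real_derivative (4 * c\<^sup>2 - a\<^sup>2) * sin (\<phi> s)) (at s within I)"
proof -
  \<comment> \<open>The derivative is \<open>2 v v' - 8 c^2 (tan \<phi> / cos^2 \<phi>) v\<close>,
    which vanishes by the equation for \<open>v\<close>.\<close>
  have "((\<lambda>s. (v s)\<^sup>2 - 4 * c\<^sup>2 * (tan (\<phi> s))\<^sup>2) has_real_derivative 0) (at s within I)"
    if "s \<in> I" for s
    by (rule derivative_eq_intros \<phi>[OF that] v[OF that] refl
        | use range[OF that] in \<open>simp add: field_simps; fail\<close>)+
  from eq_if_derivative_zero[OF \<open>convex I\<close> s I0 this]
  have energy: "(v s)\<^sup>2 = a\<^sup>2 + 4 * c\<^sup>2 * (tan (\<phi> s))\<^sup>2"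
    using \<open>\<phi> 0 = 0\<close> \<open>v 0 = a\<close> by simp
  define x where "x = cos (\<phi> s)"
  have x: "x > 0" "(sin (\<phi> s))\<^sup>2 = 1 - x\<^sup>2"
    unfolding x_def by (fact range[OF s] sin_squared_eq)+
  \<comment> \<open>Inserting the energy, the two terms with \<open>c\<close> combine to
    \<open>4 c^2 (1 - sin^2 \<phi>) / cos^2 \<phi>\<close>, which is the constant
    \<open>4 c^2\<close>.\<close>
  have "x * (4 * c\<^sup>2 * (tan (\<phi> s) / x\<^sup>2)) - sin (\<phi> s) * (v s)\<^sup>2
      = sin (\<phi> s) * (4 * c\<^sup>2 * (1 - (sin (\<phi> s))\<^sup>2) / x\<^sup>2 - a\<^sup>2)"
    using x(1) unfolding energy tan_def x_def[symmetric]
    by (simp add: power_divide diff_divide_distrib algebra_simps)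
  also have "\<dots> = (4 * c\<^sup>2 - a\<^sup>2) * sin (\<phi> s)"
    unfolding x(2) using x(1) by simp
  finally have eq: "x * (4 * c\<^sup>2 * (tan (\<phi> s) / x\<^sup>2)) - sin (\<phi> s) * (v s)\<^sup>2
      = (4 * c\<^sup>2 - a\<^sup>2) * sin (\<phi> s)" .
  have "((\<lambda>s. cos (\<phi> s) * v s) has_real_derivative
      x * (4 * c\<^sup>2 * (tan (\<phi> s) / x\<^sup>2)) - sin (\<phi> s) * (v s)\<^sup>2) (at s within I)"
    unfolding x_def by (rule derivative_eq_intros \<phi> v s refl)+ (simp add: power2_eq_square)
  then show ?thesis
    unfolding eq .
qed

text \<open>One sign \<open>\<sigma>\<close> serves all \<open>s\<close> in \<open>I\<close>.
  Integrability is asserted next to each integral, because the integral of a non-integrable function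
  has the default value 0 and the formula alone would not exclude that case.\<close>

theorem theorem5:
  fixes I :: "real set" and \<phi> \<chi>1 \<chi>2 :: "real \<Rightarrow> real" and a c \<chi>20 :: real
  assumes "is_interval I" and "0 \<in> interior I"
    and "geodesic I \<phi> \<chi>1 \<chi>2"
    and "\<phi> 0 = 0" and "\<chi>1 0 = 0" and "\<chi>2 0 = \<chi>20"
    and "(\<phi> has_real_derivative a) (at 0)" and "a \<noteq> 0"
    and "\<And>s. s \<in> I \<Longrightarrow> (\<chi>2 has_real_derivative c) (at s within I)"
  shows "\<exists>\<sigma>\<in>{1, -1::real}. \<forall>s\<in>I.
    \<chi>2 s = c * s + \<chi>20 \<and>
    (4 * c\<^sup>2 = a\<^sup>2 \<longrightarrow>
      sin (\<phi> s) = \<sigma> * (\<bar>a\<bar> * s) \<and>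
      \<chi>1 s = - c * s + c / (2 * a) * ln \<bar>(1 + a * s) / (1 - a * s)\<bar>) \<and>
    (4 * c\<^sup>2 > a\<^sup>2 \<longrightarrow>
      sin (\<phi> s) = \<sigma> * (sqrt (a\<^sup>2 / (4 * c\<^sup>2 - a\<^sup>2)) * sinh (s * sqrt (4 * c\<^sup>2 - a\<^sup>2))) \<and>
      interval_lebesgue_integrable lborel 0 (ereal s)
        (\<lambda>t. (4 * c\<^sup>2 - a\<^sup>2) / (4 * c\<^sup>2 - a\<^sup>2 * (cosh (t * sqrt (4 * c\<^sup>2 - a\<^sup>2)))\<^sup>2)) \<and>
      \<chi>1 s = - c * s + c * (LBINT t=0..ereal s.
        (4 * c\<^sup>2 - a\<^sup>2) / (4 * c\<^sup>2 - a\<^sup>2 * (cosh (t * sqrt (4 * c\<^sup>2 - a\<^sup>2)))\<^sup>2))) \<and>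
    (4 * c\<^sup>2 < a\<^sup>2 \<longrightarrow>
      sin (\<phi> s) = \<sigma> * (sqrt (a\<^sup>2 / (a\<^sup>2 - 4 * c\<^sup>2)) * sin (s * sqrt (a\<^sup>2 - 4 * c\<^sup>2))) \<and>
      interval_lebesgue_integrable lborel 0 (ereal s)
        (\<lambda>t. (a\<^sup>2 - 4 * c\<^sup>2) / (a\<^sup>2 * (cos (t * sqrt (a\<^sup>2 - 4 * c\<^sup>2)))\<^sup>2 - 4 * c\<^sup>2)) \<and>
      \<chi>1 s = - c * s + c * (LBINT t=0..ereal s.
        (a\<^sup>2 - 4 * c\<^sup>2) / (a\<^sup>2 * (cos (t * sqrt (a\<^sup>2 - 4 * c\<^sup>2)))\<^sup>2 - 4 * c\<^sup>2)))"
proof -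

  \<comment> \<open>Hamilton's equations and the constants of motion\<close>
  have I0: "0 \<in> I" and "convex I"
    using assms(1,2) interior_subset is_interval_convex by auto
  \<comment> \<open>As \<open>0\<close> is interior, derivatives at \<open>0\<close> within
    \<open>I\<close> are two-sided and unique; this identifies \<open>\<xi>\<close> with
    \<open>c\<close> and \<open>- 4 * \<psi> 0\<close> with \<open>a\<close>.\<close>
  have at0: "at 0 within I = at 0"
    using assms(2) by (rule at_within_interior)
  obtain \<psi> \<xi> where range: "\<And>s. s \<in> I \<Longrightarrow> \<phi> s \<in> {- pi / 2 <..< pi / 2}"
    and \<chi>1: "\<And>s. s \<in> I \<Longrightarrow> (\<chi>1 has_real_derivative \<xi> * (tan (\<phi> s))\<^sup>2) (at s within I)"
    and \<chi>2: "\<And>s. s \<in> I \<Longrightarrow> (\<chi>2 has_real_derivative \<xi>) (at s within I)"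
    and \<phi>: "\<And>s. s \<in> I \<Longrightarrow> (\<phi> has_real_derivative - 4 * \<psi> s) (at s within I)"
    and \<psi>: "\<And>s. s \<in> I \<Longrightarrow>
      (\<psi> has_real_derivative - \<xi>\<^sup>2 * (tan (\<phi> s) / (cos (\<phi> s))\<^sup>2)) (at s within I)"
    using assms(3) unfolding geodesic_iff[OF assms(1)] by blast
  have [simp]: "\<xi> = c"
    using \<chi>2[OF I0] assms(9)[OF I0] unfolding at0 by (rule DERIV_unique)
  have v0: "- 4 * \<psi> 0 = a"
    using \<phi>[OF I0] assms(7) unfolding at0 by (rule DERIV_unique)
  have cos_pos: "cos (\<phi> s) > 0" if "s \<in> I" for s
    using range[OF that] by (intro cos_gt_zero_pi) auto
  have v: "((\<lambda>s. - 4 * \<psi> s) has_real_derivative 4 * c\<^sup>2 * (tan (\<phi> s) / (cos (\<phi> s))\<^sup>2))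
      (at s within I)" if "s \<in> I" for s
    using DERIV_cmult[OF \<psi>[OF that], of "- 4"] by (simp add: mult.assoc)

  \<comment> \<open>The linear equation for \<open>sin \<phi>\<close>\<close>
  define k where "k = 4 * c\<^sup>2 - a\<^sup>2"
  \<comment> \<open>Each case only has to supply its fundamental pair \<open>S\<close>,
    \<open>C\<close>: \<open>s\<close> and \<open>1\<close>, then \<open>sinh (s * w) / w\<close>
    and \<open>cosh (s * w)\<close>, then \<open>sin (s * w) / w\<close> and
    \<open>cos (s * w)\<close>.\<close>
  have sin_eq: "sin (\<phi> s) = a * S s"
    if "\<And>s. (S has_real_derivative C s) (at s)"
      and "\<And>s. (C has_real_derivative k * S s) (at s)"
      and "\<And>s. (C s)\<^sup>2 - k * (S s)\<^sup>2 = 1" "S 0 = 0" "C 0 = 1" "s \<in> I" for S C s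
  proof (rule linear_ode_unique[OF \<open>convex I\<close> I0, where y = "\<lambda>s. sin (\<phi> s)"
      and z = "\<lambda>s. cos (\<phi> s) * (- 4 * \<psi> s)" and S = S and C = C and k = k])
    show "((\<lambda>s. sin (\<phi> s)) has_real_derivative cos (\<phi> s) * (- 4 * \<psi> s)) (at s within I)"
      if "s \<in> I" for s
      by (rule derivative_eq_intros \<phi> that refl)+
    show "((\<lambda>s. cos (\<phi> s) * (- 4 * \<psi> s)) has_real_derivative k * sin (\<phi> s)) (at s within I)"
      if "s \<in> I" for s
      unfolding k_def
      by (rule sin_ode[OF \<open>convex I\<close> I0 cos_pos \<phi> v assms(4) v0 that])
    show "cos (\<phi> 0) * (- 4 * \<psi> 0) = a"
      unfolding v0 by (simp add: assms(4))
  qed (use that assms(4) in \<open>auto intro: has_field_derivative_at_within\<close>)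

  \<comment> \<open>Integration of \<open>\<chi>1\<close> and \<open>\<chi>2\<close>\<close>
  have \<chi>1_deriv: "(\<chi>1 has_real_derivative c * (1 / (1 - (sin (\<phi> s))\<^sup>2)) - c) (at s within I)"
    and sin_less: "(sin (\<phi> s))\<^sup>2 < 1" if "s \<in> I" for s
  proof -
    have "(cos (\<phi> s))\<^sup>2 > 0"
      using cos_pos[OF that] by simp
    then show "(sin (\<phi> s))\<^sup>2 < 1"
      by (simp add: cos_squared_eq)
    have "(tan (\<phi> s))\<^sup>2 = 1 / (1 - (sin (\<phi> s))\<^sup>2) - 1"
      using cos_pos[OF that] unfolding cos_squared_eq[symmetric] tan_def
      by (simp add: field_simps sin_squared_eq)
    then have "\<xi> * (tan (\<phi> s))\<^sup>2 = c * (1 / (1 - (sin (\<phi> s))\<^sup>2)) - c"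
      by (simp add: right_diff_distrib)
    then show "(\<chi>1 has_real_derivative c * (1 / (1 - (sin (\<phi> s))\<^sup>2)) - c) (at s within I)"
      using \<chi>1[OF that] by (simp only:)
  qed
  have \<chi>1_integral: "interval_lebesgue_integrable lborel 0 (ereal s) f"
      "\<chi>1 s = - c * s + c * (LBINT t=0..ereal s. f t)"
    if s: "s \<in> I" and f: "f = (\<lambda>t. 1 / (1 - (a * S t)\<^sup>2))" and S: "continuous_on UNIV S"
      and sin: "\<And>t. t \<in> I \<Longrightarrow> sin (\<phi> t) = a * S t" for f S s
  proof -
    have "continuous_on I S"
      using S continuous_on_subset by blast
    \<comment> \<open>The denominator of \<open>f\<close> may vanish elsewhere, but on
      \<open>I\<close> it equals \<open>cos^2 \<phi>\<close>, which is positive.\<close>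
    then have cont: "continuous_on I f"
      unfolding f using sin_less sin by (force intro!: continuous_intros)
    \<comment> \<open>Adding \<open>c * t\<close> absorbs the \<open>- c\<close> left over from
      \<open>tan^2 \<phi> = 1 / cos^2 \<phi> - 1\<close>.\<close>
    have "((\<lambda>t. \<chi>1 t + c * t) has_real_derivative c * f t) (at t within I)" if "t \<in> I" for t
      by (rule derivative_eq_intros \<chi>1_deriv that refl)+ (simp add: f sin that)
    note int = interval_integral_of_derivative[OF assms(1) I0 s cont this]
    show "interval_lebesgue_integrable lborel 0 (ereal s) f"
      "\<chi>1 s = - c * s + c * (LBINT t=0..ereal s. f t)"
      using int assms(5) by auto
  qed
  have \<chi>2_eq: "\<chi>2 s = c * s + \<chi>20" if s: "s \<in> I" for s
  proof -
    have "((\<lambda>t. \<chi>2 t - c * t) has_real_derivative 0) (at t within I)" if "t \<in> I" for t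
      by (rule derivative_eq_intros assms(9) that refl)+ simp
    from eq_if_derivative_zero[OF \<open>convex I\<close> s I0 this]
    have "\<chi>2 s - c * s = \<chi>2 0 - c * 0"
      by simp
    then show ?thesis
      using assms(6) by simp
  qed
  have sgn_a: "sgn a * \<bar>a\<bar> = a"
    by (simp add: sgn_mult_abs)

  \<comment> \<open>Case \<open>k = 0\<close>: linear growth of \<open>sin \<phi>\<close>\<close>
  have case1: "sin (\<phi> s) = a * s"
      "\<chi>1 s = - c * s + c / (2 * a) * ln \<bar>(1 + a * s) / (1 - a * s)\<bar>"
    if eq: "4 * c\<^sup>2 = a\<^sup>2" and s: "s \<in> I" for s
  proof -
    have sin: "sin (\<phi> t) = a * t" if "t \<in> I" for t
      by (rule sin_eq[where C = "\<lambda>_. 1"])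
        (auto simp: k_def eq that intro!: derivative_eq_intros)
    then show "sin (\<phi> s) = a * s"
      using s .
    have less: "\<bar>a * t\<bar> < 1" if "t \<in> I" for t
      using sin_less[OF that] sin[OF that] by (simp add: abs_square_less_1)
    \<comment> \<open>By partial fractions \<open>g\<close> is a primitive of
      \<open>c / (1 - a^2 t^2)\<close>. Both logarithms have positive arguments on \<open>I\<close>
      by \<open>less\<close>, so the absolute value enters only in the final formula.\<close>
    define g where "g = (\<lambda>t. c / (2 * a) * (ln (1 + a * t) - ln (1 - a * t)))"
    have "((\<lambda>t. \<chi>1 t + c * t - g t) has_real_derivative 0) (at t within I)" if t: "t \<in> I" for t
    proof -
      have pos: "1 + a * t > 0" "1 - a * t > 0"
        using less[OF t] by auto
      have "((\<lambda>t. ln (1 + a * t) - ln (1 - a * t)) has_real_derivative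
          a / (1 + a * t) + a / (1 - a * t)) (at t within I)"
        using pos by (auto intro!: derivative_eq_intros simp: divide_inverse)
      then have "(g has_real_derivative c / (2 * a) * (a / (1 + a * t) + a / (1 - a * t)))
          (at t within I)"
        unfolding g_def by (rule DERIV_cmult)
      moreover have "c / (2 * a) * (a / (1 + a * t) + a / (1 - a * t)) = c * (1 / (1 - (sin (\<phi> t))\<^sup>2))"
      proof -
        have "a / (1 + a * t) + a / (1 - a * t) = 2 * a / ((1 + a * t) * (1 - a * t))"
          using pos by (subst add_frac_eq) (simp_all add: algebra_simps)
        also have "(1 + a * t) * (1 - a * t) = 1 - (sin (\<phi> t))\<^sup>2"
          by (simp add: sin[OF t] algebra_simps power2_eq_square)
        finally show ?thesis
          using \<open>a \<noteq> 0\<close> by simp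
      qed
      ultimately have g: "(g has_real_derivative c * (1 / (1 - (sin (\<phi> t))\<^sup>2))) (at t within I)"
        by metis
      show ?thesis
        by (rule derivative_eq_intros \<chi>1_deriv g t refl)+ simp
    qed
    from eq_if_derivative_zero[OF \<open>convex I\<close> s I0 this]
    have "\<chi>1 s + c * s - g s = \<chi>1 0 + c * 0 - g 0"
      by simp
    then have "\<chi>1 s = - c * s + g s"
      using assms(5) by (simp add: g_def)
    moreover have "ln \<bar>(1 + a * s) / (1 - a * s)\<bar> = ln (1 + a * s) - ln (1 - a * s)"
    proof -
      have "1 + a * s > 0" "1 - a * s > 0"
        using less[OF s] by auto
      then show ?thesis
        by (simp add: abs_divide ln_div)
    qed
    ultimately show "\<chi>1 s = - c * s + c / (2 * a) * ln \<bar>(1 + a * s) / (1 - a * s)\<bar>"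
      by (simp add: g_def)
  qed

  \<comment> \<open>Case \<open>k > 0\<close>: hyperbolic solutions\<close>
  define w where "w = sqrt \<bar>k\<bar>"
  have w2: "w\<^sup>2 = \<bar>k\<bar>"
    by (simp add: w_def)
  have case2: "sin (\<phi> s) = a * (sinh (s * w) / w)"
      "interval_lebesgue_integrable lborel 0 (ereal s) (\<lambda>t. k / (4 * c\<^sup>2 - a\<^sup>2 * (cosh (t * w))\<^sup>2))"
      "\<chi>1 s = - c * s + c * (LBINT t=0..ereal s. k / (4 * c\<^sup>2 - a\<^sup>2 * (cosh (t * w))\<^sup>2))"
    if pos: "k > 0" and s: "s \<in> I" for s
  proof -
    have w: "w > 0" and k: "k = w * w"
      using pos w2 by (auto simp: w_def power2_eq_square)
    have sin: "sin (\<phi> t) = a * (sinh (t * w) / w)" if "t \<in> I" for t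
    proof (rule sin_eq[where C = "\<lambda>t. cosh (t * w)"])
      show "((\<lambda>t. sinh (t * w) / w) has_real_derivative cosh (t * w)) (at t)"
        and "((\<lambda>t. cosh (t * w)) has_real_derivative k * (sinh (t * w) / w)) (at t)" for t
        using w by (auto intro!: derivative_eq_intros simp: k)
      have "k * (sinh (t * w) / w)\<^sup>2 = (sinh (t * w))\<^sup>2" for t
        using w by (simp add: k power2_eq_square)
      then show "(cosh (t * w))\<^sup>2 - k * (sinh (t * w) / w)\<^sup>2 = 1" for t
        by (simp add: cosh_square_eq)
    qed (use that in simp_all)
    then show "sin (\<phi> s) = a * (sinh (s * w) / w)"
      using s .
    \<comment> \<open>With \<open>sinh^2 = cosh^2 - 1\<close> the extra \<open>a^2\<close> cancels
      the one in \<open>k = 4 c^2 - a^2\<close>; this gives the denominator of the stated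
      integrand.\<close>
    have "1 - (a * (sinh (t * w) / w))\<^sup>2 = (4 * c\<^sup>2 - a\<^sup>2 * (cosh (t * w))\<^sup>2) / k" for t
    proof -
      have "(a * (sinh (t * w) / w))\<^sup>2 = a\<^sup>2 * ((cosh (t * w))\<^sup>2 - 1) / k"
        by (simp add: sinh_square_eq power_mult_distrib power_divide k flip: power2_eq_square)
      then have "1 - (a * (sinh (t * w) / w))\<^sup>2 = (k - a\<^sup>2 * ((cosh (t * w))\<^sup>2 - 1)) / k"
        using pos by (simp add: diff_divide_distrib)
      also have "k - a\<^sup>2 * ((cosh (t * w))\<^sup>2 - 1) = 4 * c\<^sup>2 - a\<^sup>2 * (cosh (t * w))\<^sup>2"
        by (simp add: k_def algebra_simps)
      finally show ?thesis .
    qed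
    then have f: "(\<lambda>t. k / (4 * c\<^sup>2 - a\<^sup>2 * (cosh (t * w))\<^sup>2)) = (\<lambda>t. 1 / (1 - (a * (sinh (t * w) / w))\<^sup>2))"
      by simp
    have cont: "continuous_on UNIV (\<lambda>t. sinh (t * w) / w)"
      using w by (intro continuous_intros) auto
    show "interval_lebesgue_integrable lborel 0 (ereal s) (\<lambda>t. k / (4 * c\<^sup>2 - a\<^sup>2 * (cosh (t * w))\<^sup>2))"
      "\<chi>1 s = - c * s + c * (LBINT t=0..ereal s. k / (4 * c\<^sup>2 - a\<^sup>2 * (cosh (t * w))\<^sup>2))"
      by (rule \<chi>1_integral[OF s f cont sin]; assumption)+
  qed

  \<comment> \<open>Case \<open>k < 0\<close>: trigonometric solutions\<close>
  have case3: "sin (\<phi> s) = a * (sin (s * w) / w)"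
      "interval_lebesgue_integrable lborel 0 (ereal s) (\<lambda>t. - k / (a\<^sup>2 * (cos (t * w))\<^sup>2 - 4 * c\<^sup>2))"
      "\<chi>1 s = - c * s + c * (LBINT t=0..ereal s. - k / (a\<^sup>2 * (cos (t * w))\<^sup>2 - 4 * c\<^sup>2))"
    if neg: "k < 0" and s: "s \<in> I" for s
  proof -
    have w: "w > 0" and k: "k = - (w * w)"
      using neg w2 by (auto simp: w_def power2_eq_square)
    have sin: "sin (\<phi> t) = a * (sin (t * w) / w)" if "t \<in> I" for t
    proof (rule sin_eq[where C = "\<lambda>t. cos (t * w)"])
      show "((\<lambda>t. sin (t * w) / w) has_real_derivative cos (t * w)) (at t)"
        and "((\<lambda>t. cos (t * w)) has_real_derivative k * (sin (t * w) / w)) (at t)" for t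
        using w by (auto intro!: derivative_eq_intros simp: k)
      have "k * (sin (t * w) / w)\<^sup>2 = - (sin (t * w))\<^sup>2" for t
        using w by (simp add: k power2_eq_square)
      then show "(cos (t * w))\<^sup>2 - k * (sin (t * w) / w)\<^sup>2 = 1" for t
        by (simp)
    qed (use that in simp_all)
    then show "sin (\<phi> s) = a * (sin (s * w) / w)"
      using s .
    \<comment> \<open>The same cancellation with \<open>sin^2 = 1 - cos^2\<close>; dividing by the
      positive number \<open>- k\<close> gives the signs of the stated integrand.\<close>
    have "1 - (a * (sin (t * w) / w))\<^sup>2 = (a\<^sup>2 * (cos (t * w))\<^sup>2 - 4 * c\<^sup>2) / - k" for t
    proof -
      have "(a * (sin (t * w) / w))\<^sup>2 = a\<^sup>2 * (1 - (cos (t * w))\<^sup>2) / - k"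
        by (simp add: sin_squared_eq power_mult_distrib power_divide k flip: power2_eq_square)
      then have "1 - (a * (sin (t * w) / w))\<^sup>2 = (- k - a\<^sup>2 * (1 - (cos (t * w))\<^sup>2)) / - k"
        using neg by (simp add: diff_divide_distrib)
      also have "- k - a\<^sup>2 * (1 - (cos (t * w))\<^sup>2) = a\<^sup>2 * (cos (t * w))\<^sup>2 - 4 * c\<^sup>2"
        by (simp add: k_def algebra_simps)
      finally show ?thesis .
    qed
    then have f: "(\<lambda>t. - k / (a\<^sup>2 * (cos (t * w))\<^sup>2 - 4 * c\<^sup>2)) = (\<lambda>t. 1 / (1 - (a * (sin (t * w) / w))\<^sup>2))"
      by simp
    have cont: "continuous_on UNIV (\<lambda>t. sin (t * w) / w)"
      using w by (intro continuous_intros) auto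
    show "interval_lebesgue_integrable lborel 0 (ereal s) (\<lambda>t. - k / (a\<^sup>2 * (cos (t * w))\<^sup>2 - 4 * c\<^sup>2))"
      "\<chi>1 s = - c * s + c * (LBINT t=0..ereal s. - k / (a\<^sup>2 * (cos (t * w))\<^sup>2 - 4 * c\<^sup>2))"
      by (rule \<chi>1_integral[OF s f cont sin]; assumption)+
  qed

  \<comment> \<open>Choice of the sign and assembly of the cases\<close>
  have root: "sgn a * (sqrt (a\<^sup>2 / \<bar>k\<bar>) * x) = a * (x / w)" for x
  proof -
    \<comment> \<open>\<open>sqrt (a^2 / \<bar>k\<bar>)\<close> is \<open>\<bar>a\<bar> / w\<close>,
      so the stated amplitude with sign \<open>sgn a\<close> is exactly
      \<open>a / w\<close>.\<close>
    have "sgn a * (sqrt (a\<^sup>2 / \<bar>k\<bar>) * x) = (sgn a * \<bar>a\<bar>) * (x / w)"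
      by (simp only: real_sqrt_divide real_sqrt_abs w_def) simp
    then show ?thesis
      unfolding sgn_a .
  qed
  show ?thesis
  \<comment> \<open>\<open>sin \<phi>\<close> leaves \<open>0\<close> with slope \<open>a\<close>,
    so the sign is that of \<open>a\<close> in all three cases.\<close>
  proof (intro bexI[of _ "sgn a"] ballI conjI impI)
    show "sgn a \<in> {1, -1}"
      using \<open>a \<noteq> 0\<close> by (simp add: sgn_if)
  next
    fix s assume s: "s \<in> I"
    show "\<chi>2 s = c * s + \<chi>20"
      using s by (rule \<chi>2_eq)
    {
      assume "4 * c\<^sup>2 = a\<^sup>2"
      note case1[OF this s]
      then show "sin (\<phi> s) = sgn a * (\<bar>a\<bar> * s)"
        and "\<chi>1 s = - c * s + c / (2 * a) * ln \<bar>(1 + a * s) / (1 - a * s)\<bar>"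
        by (simp_all only: mult.assoc[symmetric] sgn_a)
    next
      assume "a\<^sup>2 < 4 * c\<^sup>2"
      then have "k > 0" and k: "4 * c\<^sup>2 - a\<^sup>2 = k" and w: "sqrt k = w" "\<bar>k\<bar> = k"
        by (simp_all add: k_def w_def)
      show "sin (\<phi> s) = sgn a * (sqrt (a\<^sup>2 / (4 * c\<^sup>2 - a\<^sup>2)) * sinh (s * sqrt (4 * c\<^sup>2 - a\<^sup>2)))"
        and "interval_lebesgue_integrable lborel 0 (ereal s)
          (\<lambda>t. (4 * c\<^sup>2 - a\<^sup>2) / (4 * c\<^sup>2 - a\<^sup>2 * (cosh (t * sqrt (4 * c\<^sup>2 - a\<^sup>2)))\<^sup>2))"
        and "\<chi>1 s = - c * s + c * (LBINT t=0..ereal s.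
          (4 * c\<^sup>2 - a\<^sup>2) / (4 * c\<^sup>2 - a\<^sup>2 * (cosh (t * sqrt (4 * c\<^sup>2 - a\<^sup>2)))\<^sup>2))"
        unfolding k w(1) by (rule case2[OF \<open>k > 0\<close> s, folded root, unfolded w(2)])+
    next
      assume "4 * c\<^sup>2 < a\<^sup>2"
      then have "k < 0" and k: "a\<^sup>2 - 4 * c\<^sup>2 = - k" and w: "sqrt (- k) = w" "\<bar>k\<bar> = - k"
        by (simp_all add: k_def w_def)
      show "sin (\<phi> s) = sgn a * (sqrt (a\<^sup>2 / (a\<^sup>2 - 4 * c\<^sup>2)) * sin (s * sqrt (a\<^sup>2 - 4 * c\<^sup>2)))"
        and "interval_lebesgue_integrable lborel 0 (ereal s)
          (\<lambda>t. (a\<^sup>2 - 4 * c\<^sup>2) / (a\<^sup>2 * (cos (t * sqrt (a\<^sup>2 - 4 * c\<^sup>2)))\<^sup>2 - 4 * c\<^sup>2))"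
        and "\<chi>1 s = - c * s + c * (LBINT t=0..ereal s.
          (a\<^sup>2 - 4 * c\<^sup>2) / (a\<^sup>2 * (cos (t * sqrt (a\<^sup>2 - 4 * c\<^sup>2)))\<^sup>2 - 4 * c\<^sup>2))"
        unfolding k w(1) by (rule case3[OF \<open>k < 0\<close> s, folded root, unfolded w(2)])+
    }
  qed
qed

end
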